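(* Let $m\ge 2$ and let $(a_0,a_1,\dots,a_m)$ be a sequence of positive integers such that for every $0\le i\le m-1$, $a_i=b_{i+1}a_{i+1}$ for some integer $b_{i+1}\ge 2$. Then for every choice of integers $\eta_1,\dots,\eta_m$ with $1\le\eta_i\le b_i-1$, there exists a non-disjoint $$\Big(a_0,\,m,\,\eta_1a_1,\,\eta_2a_2\tfrac{a_0}{a_1},\,\eta_3a_3\tfrac{a_0}{a_2},\,\dots,\,\eta_ma_m\tfrac{a_0}{a_{m-1}}\Big)\text{-GPSEDF in }\mathbb{Z}_{a_0},$$ and its $\lambda$-matrix $[a_{ij}]_{m\times m}$ has $a_{ii}=0$ and $a_{ij}=\lambda_{i,j}=\frac{a_0\eta_ia_i\eta_ja_j}{a_{i-1}a_{j-1}}$ for $i\ne j$.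
   Context: For subsets $A,B$ of an additively written group $G$, $\Delta(A,B)$ denotes the multiset $\{a-b:a\in A,b\in B\}$ (one entry per pair). For $\lambda\in\mathbb{N}\cup\{0\}$, $\lambda G$ is the multiset containing every element of $G$ exactly $\lambda$ times. Let $|G|=v$. A family of sets $\{A_1,\dots,A_m\}$ in $G$ with $|A_i|=k_i$ is a non-disjoint $(v,m,k_1,\dots,k_m)$-GPSEDF if $\Delta(A_i,A_j)=\lambda_{i,j}G$ with $\lambda_{i,j}=k_ik_j/v$ for all $1\le i\ne j\le m$. Its $\lambda$-matrix is the $m\times m$ matrix with diagonal entries $0$ and $(i,j)$ entry $\lambda_{i,j}$ for $i\neq j$. *)

theory Defs
  imports "HOL-Algebra.Elementary_Groups" "HOL-Library.Multiset" "Jordan_Normal_Form.Matrix"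
begin

text \<open>
  Groups are written multiplicatively in HOL-Algebra, so the difference \<open>x - y\<close> of the
  additive notation is \<open>x \<otimes> inv y\<close>; the cyclic group of order \<open>n\<close> is \<open>integer_mod_group n\<close>.
  The multiset \<open>\<Delta>(A,B)\<close> has one entry for each pair of \<open>A \<times> B\<close>.
\<close>

definition diff_mset :: "('a, 'b) monoid_scheme \<Rightarrow> 'a set \<Rightarrow> 'a set \<Rightarrow> 'a multiset" where
  "diff_mset G A B = image_mset (\<lambda>(x, y). x \<otimes>\<^bsub>G\<^esub> inv\<^bsub>G\<^esub> y) (mset_set (A \<times> B))"

definition group_mset :: "nat \<Rightarrow> ('a, 'b) monoid_scheme \<Rightarrow> 'a multiset" where
  "group_mset l G = repeat_mset l (mset_set (carrier G))"

definition gpsedf_lambda :: "('a, 'b) monoid_scheme \<Rightarrow> (nat \<Rightarrow> 'a set) \<Rightarrow> nat \<Rightarrow> nat \<Rightarrow> rat" where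
  "gpsedf_lambda G A i j = of_nat (card (A i)) * of_nat (card (A j)) / of_nat (order G)"

text \<open>
  A family \<open>A\<^sub>1, \<dots>, A\<^sub>m\<close> is a function on \<open>{1..m}\<close>. The quotient \<open>gpsedf_lambda\<close> is rational,
  so the definition demands that it be a natural number. No disjointness is imposed: the
  adjective ``non-disjoint'' says that the sets are allowed to meet.
\<close>

definition nondisjoint_gpsedf ::
    "('a, 'b) monoid_scheme \<Rightarrow> nat \<Rightarrow> nat \<Rightarrow> (nat \<Rightarrow> nat) \<Rightarrow> (nat \<Rightarrow> 'a set) \<Rightarrow> bool" where
  "nondisjoint_gpsedf G v m k A \<longleftrightarrow>
     group G \<and> finite (carrier G) \<and> order G = v \<and>
     (\<forall>i\<in>{1..m}. A i \<subseteq> carrier G \<and> card (A i) = k i) \<and>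
     (\<forall>i\<in>{1..m}. \<forall>j\<in>{1..m}. i \<noteq> j \<longrightarrow>
        (\<exists>l::nat. of_nat l = gpsedf_lambda G A i j \<and> diff_mset G (A i) (A j) = group_mset l G))"

text \<open>Matrix indices start at 0, hence the shift by \<open>Suc\<close>.\<close>

definition lambda_matrix :: "('a, 'b) monoid_scheme \<Rightarrow> nat \<Rightarrow> (nat \<Rightarrow> 'a set) \<Rightarrow> rat mat" where
  "lambda_matrix G m A =
     mat m m (\<lambda>(r, c). if r = c then 0 else gpsedf_lambda G A (Suc r) (Suc c))"

end

theory Submission
  imports Defs
begin

text \<open>
  Take \<open>A\<^sub>i = {x \<in> \<int>\<^bsub>a\<^sub>0\<^esub>. x mod a\<^bsub>i-1\<^esub> < \<eta>\<^sub>i a\<^sub>i}\<close>. Let \<open>i < j\<close>. Within each period \<open>a\<^bsub>i-1\<^esub>\<close>, the set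
  \<open>A\<^sub>i\<close> is an interval consisting of \<open>\<eta>\<^sub>i\<close> blocks of length \<open>a\<^sub>i\<close>, so it is equidistributed over
  the residue classes modulo \<open>a\<^sub>i\<close>; on the other hand \<open>A\<^sub>j\<close> and all its translates are unions of
  such classes, because \<open>a\<^bsub>j-1\<^esub>\<close> divides \<open>a\<^sub>i\<close>. Hence \<open>A\<^sub>i\<close> meets every translate of \<open>A\<^sub>j\<close>
  in the same number of points. The case \<open>i > j\<close> follows by negating differences.
\<close>

text \<open>In a pair with difference \<open>g\<close>, the first entry \<open>x\<close> determines
  the second as \<open>inv g \<otimes> x\<close>, so it suffices to count first entries.\<close>

lemma (in group) count_diff_mset:
  assumes "finite A" "finite B" "A \<subseteq> carrier G" "B \<subseteq> carrier G" "g \<in> carrier G"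
  shows "count (diff_mset G A B) g = card {x \<in> A. inv g \<otimes> x \<in> B}"
proof -
  have eq: "x \<otimes> inv y = g \<longleftrightarrow> y = inv g \<otimes> x" if "x \<in> carrier G" "y \<in> carrier G" for x y
    using that assms(5) by (metis inv_solve_left inv_solve_right)
  have "count (diff_mset G A B) g = card {p \<in> A \<times> B. fst p \<otimes> inv (snd p) = g}"
    using assms(1,2)
    by (auto simp: diff_mset_def count_image_mset case_prod_beta vimage_def
        intro!: arg_cong[where f = card])
  also have "{p \<in> A \<times> B. fst p \<otimes> inv (snd p) = g} = {p \<in> A \<times> B. snd p = inv g \<otimes> fst p}"
    using assms(3,4) by (intro Collect_cong conj_cong refl eq) auto
  also have "\<dots> = (\<lambda>x. (x, inv g \<otimes> x)) ` {x \<in> A. inv g \<otimes> x \<in> B}"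
    by auto
  also have "card \<dots> = card {x \<in> A. inv g \<otimes> x \<in> B}"
    by (rule card_image) (simp add: inj_on_def)
  finally show ?thesis .
qed

text \<open>Turns the multiset identity into a count of the points that \<open>A\<close> shares with
  each translate of \<open>B\<close>; off the carrier both multiplicities vanish.\<close>

lemma (in group) diff_mset_eq_group_mset_iff:
  assumes "finite (carrier G)" "A \<subseteq> carrier G" "B \<subseteq> carrier G"
  shows "diff_mset G A B = group_mset l G \<longleftrightarrow> (\<forall>g\<in>carrier G. card {x \<in> A. inv g \<otimes> x \<in> B} = l)"
proof -
  have fin: "finite A" "finite B" using assms finite_subset by blast+
  have out: "count (diff_mset G A B) g = 0" if "g \<notin> carrier G" for g
    using that assms(2,3) fin by (auto simp: diff_mset_def not_in_iff[symmetric])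
  have "diff_mset G A B = group_mset l G \<longleftrightarrow> (\<forall>g\<in>carrier G. count (diff_mset G A B) g = l)"
    using assms(1) out by (auto simp: multiset_eq_iff group_mset_def count_mset_set')
  then show ?thesis using count_diff_mset[OF fin assms(2,3)] by simp
qed

lemma (in group) diff_mset_eq_group_mset_swap:
  assumes "finite (carrier G)" "A \<subseteq> carrier G" "B \<subseteq> carrier G"
    and "diff_mset G A B = group_mset l G"
  shows "diff_mset G B A = group_mset l G"
  unfolding diff_mset_eq_group_mset_iff[OF assms(1,3,2)]
proof
  fix g assume g: "g \<in> carrier G"
  \<comment> \<open>Left translation by \<open>inv g\<close> turns the exchanged count at
    \<open>g\<close> into the original count at \<open>inv g\<close>.\<close>
  have "bij_betw (\<lambda>y. inv g \<otimes> y) {y \<in> B. inv g \<otimes> y \<in> A} {x \<in> A. g \<otimes> x \<in> B}"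
    using g assms(2,3)
    by (intro bij_betw_byWitness[where f' = "\<lambda>x. g \<otimes> x"]) (auto simp: subset_iff m_assoc[symmetric])
  then have "card {y \<in> B. inv g \<otimes> y \<in> A} = card {x \<in> A. inv (inv g) \<otimes> x \<in> B}"
    using g by (simp add: bij_betw_same_card)
  also have "\<dots> = l"
    using assms(4) g diff_mset_eq_group_mset_iff[OF assms(1-3)] by blast
  finally show "card {y \<in> B. inv g \<otimes> y \<in> A} = l" .
qed

text \<open>Any \<open>d\<close> consecutive integers represent each residue modulo \<open>d\<close>
  once, so the starting point \<open>c\<close> does not affect the count.\<close>

lemma card_periodic_int:
  fixes d c :: int
  assumes "d > 0" and per: "\<And>x. P (x mod d) \<longleftrightarrow> P x"
  shows "card {x \<in> {c..<c + int q * d}. P x} = q * card {x \<in> {0..<d}. P x}"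
proof (induction q)
  case 0
  then show ?case by simp
next
  case (Suc q)
  let ?e = "c + int q * d"
  have "bij_betw (\<lambda>x. x mod d) {x \<in> {?e..<?e + d}. P x} {x \<in> {0..<d}. P x}"
  \<comment> \<open>The inverse sends a residue to its unique representative in the window starting
    at \<open>?e\<close>.\<close>
  proof (rule bij_betw_byWitness[where f' = "\<lambda>y. ?e + (y - ?e) mod d"])
    show "\<forall>x\<in>{x \<in> {?e..<?e + d}. P x}. ?e + (x mod d - ?e) mod d = x"
      by (auto simp: mod_diff_left_eq)
    show "\<forall>y\<in>{x \<in> {0..<d}. P x}. (?e + (y - ?e) mod d) mod d = y"
      by (auto simp: mod_add_right_eq)
    show "(\<lambda>x. x mod d) ` {x \<in> {?e..<?e + d}. P x} \<subseteq> {x \<in> {0..<d}. P x}"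
      using assms by auto
    have "P (?e + (y - ?e) mod d)" if "P y" for y
      using that per[of y] per[of "?e + (y - ?e) mod d"] by (simp add: mod_add_right_eq)
    then show "(\<lambda>y. ?e + (y - ?e) mod d) ` {x \<in> {0..<d}. P x} \<subseteq> {x \<in> {?e..<?e + d}. P x}"
      using \<open>d > 0\<close> by auto
  qed
  then have block: "card {x \<in> {?e..<?e + d}. P x} = card {x \<in> {0..<d}. P x}"
    by (rule bij_betw_same_card)
  have "{c..<c + int (Suc q) * d} = {c..<?e} \<union> {?e..<?e + d}"
    using \<open>d > 0\<close> ivl_disj_un_two(3)[of c ?e "?e + d"] by (simp add: algebra_simps)
  then have split: "{x \<in> {c..<c + int (Suc q) * d}. P x} =
      {x \<in> {c..<?e}. P x} \<union> {x \<in> {?e..<?e + d}. P x}"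
    by blast
  have disj: "{x \<in> {c..<?e}. P x} \<inter> {x \<in> {?e..<?e + d}. P x} = {}"
    using ivl_disj_int_two(3)[of c ?e "?e + d"] by blast
  have "card {x \<in> {c..<c + int (Suc q) * d}. P x} =
      card {x \<in> {c..<?e}. P x} + card {x \<in> {?e..<?e + d}. P x}"
    unfolding split by (intro card_Un_disjoint disj finite_Collect_conjI disjI1; simp only: Collect_mem_eq finite_atLeastLessThan_int)
  then show ?case using Suc block by simp
qed

text \<open>In the period that starts at \<open>c\<close> nothing wraps around: the condition
  selects the first \<open>w\<close> integers. All periods contain equally many solutions.\<close>

lemma card_mod_less:
  fixes c :: int
  assumes "p > 0" "w \<le> p"
  shows "card {x \<in> {0..<int (s * p)}. (x - c) mod int p < int w} = s * w"
proof -
  let ?P = "\<lambda>x. (x - c) mod int p < int w"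
  have per: "?P (x mod int p) \<longleftrightarrow> ?P x" for x by (simp add: mod_diff_left_eq)
  have "card {x \<in> {0..<int p}. ?P x} = card {x \<in> {c..<c + int p}. ?P x}"
    using card_periodic_int[of "int p" ?P c 1] assms(1) per by simp
  also have "{x \<in> {c..<c + int p}. ?P x} = {c..<c + int w}"
    using assms(2) by auto
  finally have "card {x \<in> {0..<int p}. ?P x} = w" by simp
  then show ?thesis
    using card_periodic_int[of "int p" ?P 0 s] assms(1) per by simp
qed

text \<open>The bound on \<open>x mod int p\<close> keeps an initial stretch of each period of
  length \<open>p\<close>, and that stretch consists of \<open>e\<close> full periods of
  \<open>Q\<close>.\<close>

lemma card_mod_less_and_periodic:
  assumes "p > 0" "d > 0" "e * d \<le> p" "d dvd p" and per: "\<And>x. Q (x mod int d) \<longleftrightarrow> Q x"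
  shows "card {x \<in> {0..<int (s * p)}. x mod int p < int (e * d) \<and> Q x} =
    s * (e * card {x \<in> {0..<int d}. Q x})"
proof -
  let ?P = "\<lambda>x. x mod int p < int (e * d) \<and> Q x"
  have "Q (x mod int p) \<longleftrightarrow> Q x" for x
    using per[of "x mod int p"] per[of x] \<open>d dvd p\<close> by (simp add: mod_mod_cancel)
  then have "card {x \<in> {0..<int (s * p)}. ?P x} = s * card {x \<in> {0..<int p}. ?P x}"
    using card_periodic_int[of "int p" ?P 0 s] \<open>p > 0\<close> by simp
  moreover have "{x \<in> {0..<int p}. ?P x} = {x \<in> {0..<int e * int d}. Q x}"
  proof -
    have "int e * int d \<le> int p" using \<open>e * d \<le> p\<close> by (metis of_nat_le_iff of_nat_mult)
    then show ?thesis by auto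
  qed
  moreover have "card {x \<in> {0..<int e * int d}. Q x} = e * card {x \<in> {0..<int d}. Q x}"
    using card_periodic_int[of "int d" Q 0 e] \<open>d > 0\<close> per by simp
  ultimately show ?thesis by simp
qed

definition residue_interval :: "nat \<Rightarrow> nat \<Rightarrow> nat \<Rightarrow> int set" where
  "residue_interval n p w = {x \<in> {0..<int n}. x mod int p < int w}"

lemma residue_interval_subset: "n > 0 \<Longrightarrow> residue_interval n p w \<subseteq> carrier (integer_mod_group n)"
  by (auto simp: residue_interval_def carrier_integer_mod_group)

lemma card_residue_interval:
  assumes "p > 0" "w \<le> p" "p dvd n"
  shows "card (residue_interval n p w) = n div p * w"
  using card_mod_less[of p w "n div p" 0] assms by (simp add: residue_interval_def)

text \<open>Used with \<open>p\<close>, \<open>d\<close>, \<open>q\<close> equal to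
  \<open>a (i - 1)\<close>, \<open>a i\<close>, \<open>a (j - 1)\<close>. The divisibility chain
  makes every block of length \<open>d\<close> a union of whole periods of the second set.\<close>

lemma diff_mset_residue_interval:
  assumes "n > 0" "p dvd n" "d dvd p" "q dvd d" "e * d \<le> p" "w \<le> q"
  shows "diff_mset (integer_mod_group n) (residue_interval n p (e * d)) (residue_interval n q w) =
    group_mset (n div p * (e * (d div q * w))) (integer_mod_group n)"
proof -
  interpret group "integer_mod_group n" by simp
  have pos: "p > 0" "d > 0" "q > 0" using assms(1-4) by (auto intro!: Nat.gr0I)
  have "q dvd n" using assms(2-4) dvd_trans by blast
  have "card {x \<in> residue_interval n p (e * d).
      inv\<^bsub>integer_mod_group n\<^esub> g \<otimes>\<^bsub>integer_mod_group n\<^esub> x \<in> residue_interval n q w} =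
      n div p * (e * (d div q * w))" if g: "g \<in> carrier (integer_mod_group n)" for g
  proof -
    let ?Q = "\<lambda>x. (x - g) mod int q < int w"
    have "inv\<^bsub>integer_mod_group n\<^esub> g \<otimes>\<^bsub>integer_mod_group n\<^esub> x = (x - g) mod int n" for x
      using g by (simp add: mod_add_left_eq)
    \<comment> \<open>Since \<open>q\<close> divides \<open>n\<close>, reducing \<open>x - g\<close>
      modulo \<open>n\<close> preserves its residue modulo \<open>q\<close>.\<close>
    then have "{x \<in> residue_interval n p (e * d).
        inv\<^bsub>integer_mod_group n\<^esub> g \<otimes>\<^bsub>integer_mod_group n\<^esub> x \<in> residue_interval n q w} =
        {x \<in> {0..<int (n div p * p)}. x mod int p < int (e * d) \<and> ?Q x}"
      using \<open>q dvd n\<close> \<open>p dvd n\<close> \<open>n > 0\<close> by (auto simp: residue_interval_def mod_mod_cancel)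
    also have "card \<dots> = n div p * (e * card {x \<in> {0..<int d}. ?Q x})"
    proof (rule card_mod_less_and_periodic[OF pos(1,2) \<open>e * d \<le> p\<close> \<open>d dvd p\<close>])
      fix x
      have "(x mod int d - g) mod int q = (x - g) mod int q"
        using \<open>q dvd d\<close> by (intro mod_diff_cong) (simp_all add: mod_mod_cancel)
      then show "?Q (x mod int d) \<longleftrightarrow> ?Q x" by simp
    qed
    also have "card {x \<in> {0..<int d}. ?Q x} = d div q * w"
      using card_mod_less[of q w "d div q" g] pos(3) \<open>w \<le> q\<close> \<open>q dvd d\<close> by simp
    finally show ?thesis .
  qed
  then show ?thesis
    using assms(1) residue_interval_subset
    by (subst diff_mset_eq_group_mset_iff) (auto simp: carrier_integer_mod_group)
qed

theorem theorem3p2: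
  fixes m :: nat and a b \<eta> :: "nat \<Rightarrow> nat"
  assumes "m \<ge> 2"
    and "\<forall>i\<le>m. a i > 0"
    and "\<forall>i<m. b (i + 1) \<ge> 2 \<and> a i = b (i + 1) * a (i + 1)"
    and "\<forall>i\<in>{1..m}. 1 \<le> \<eta> i \<and> \<eta> i \<le> b i - 1"
  shows "\<exists>A. nondisjoint_gpsedf (integer_mod_group (a 0)) (a 0) m
               (\<lambda>i. \<eta> i * a i * (a 0 div a (i - 1))) A \<and>
             dim_row (lambda_matrix (integer_mod_group (a 0)) m A) = m \<and>
             dim_col (lambda_matrix (integer_mod_group (a 0)) m A) = m \<and>
             (\<forall>i\<in>{1..m}. \<forall>j\<in>{1..m}.
                lambda_matrix (integer_mod_group (a 0)) m A $$ (i - 1, j - 1) =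
                  (if i = j then 0
                   else of_nat (a 0 * \<eta> i * a i * \<eta> j * a j) / of_nat (a (i - 1) * a (j - 1))))"
proof -
  let ?G = "integer_mod_group (a 0)"
  interpret group ?G by simp
  define A where "A i = residue_interval (a 0) (a (i - 1)) (\<eta> i * a i)" for i
  have a0: "a 0 > 0" using assms(2) by simp
  have fin: "finite (carrier ?G)" and order: "order ?G = a 0"
    using a0 by (auto simp: carrier_integer_mod_group order_def)
  have sub: "A i \<subseteq> carrier ?G" for i
    unfolding A_def using a0 by (rule residue_interval_subset)
  have dvd: "a j dvd a i" if "i \<le> j" "j \<le> m" for i j
    using that
  proof (induction j rule: dec_induct)
    case (step j)
    then show ?case using assms(3) by (metis Suc_eq_plus1 Suc_le_lessD dvd_trans dvd_triv_right less_imp_le_nat)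
  qed simp
  have width: "\<eta> i * a i \<le> a (i - 1)" if "i \<in> {1..m}" for i
  proof -
    have "a (i - 1) = b i * a i" using that assms(3)[rule_format, of "i - 1"] by auto
    moreover have "\<eta> i \<le> b i" using that assms(4) by (meson diff_le_self le_trans)
    ultimately show ?thesis by simp
  qed
  have card: "card (A i) = \<eta> i * a i * (a 0 div a (i - 1))" if "i \<in> {1..m}" for i
    unfolding A_def using that assms(2) width[OF that] dvd[of 0 "i - 1"]
    by (subst card_residue_interval) auto
  \<comment> \<open>Divisibility makes the division exact, so the set sizes can be compared with the
    rational \<lambda>.\<close>
  have quot: "(of_nat (a 0 div a k) :: rat) = of_nat (a 0) / of_nat (a k)" if k: "k \<le> m" for k
  proof -
    obtain s where "a 0 = a k * s" using dvd[of 0 k] k by (auto elim: dvdE)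
    moreover have "a k > 0" using k assms(2) by simp
    ultimately show ?thesis by simp
  qed
  have lam: "gpsedf_lambda ?G A i j =
      of_nat (a 0 * \<eta> i * a i * \<eta> j * a j) / of_nat (a (i - 1) * a (j - 1))"
    if ij: "i \<in> {1..m}" "j \<in> {1..m}" for i j
  proof -
    have "i - 1 \<le> m" "j - 1 \<le> m" using ij by auto
    then show ?thesis
      using a0 by (simp add: gpsedf_lambda_def order card[OF ij(1)] card[OF ij(2)] quot)
  qed
  have lam_sym: "gpsedf_lambda ?G A i j = gpsedf_lambda ?G A j i" for i j
    by (simp add: gpsedf_lambda_def mult.commute)
  have less: "\<exists>l::nat. of_nat l = gpsedf_lambda ?G A i j \<and> diff_mset ?G (A i) (A j) = group_mset l ?G"
    if ij: "i \<in> {1..m}" "j \<in> {1..m}" "i < j" for i j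
  proof (intro exI conjI)
    \<comment> \<open>The factors count the periods of \<open>A i\<close>, the blocks of length
      \<open>a i\<close> kept in each, the periods of \<open>A j\<close> per block, and the points
      in each of those.\<close>
    let ?l = "a 0 div a (i - 1) * (\<eta> i * (a i div a (j - 1) * (\<eta> j * a j)))"
    \<comment> \<open>The last divisibility rests on \<open>i < j\<close>, that is,
      \<open>i \<le> j - 1\<close>.\<close>
    have d: "a (i - 1) dvd a 0" "a i dvd a (i - 1)" "a (j - 1) dvd a i"
      using ij by (auto intro!: dvd)
    show "diff_mset ?G (A i) (A j) = group_mset ?l ?G"
      unfolding A_def using d ij width by (intro diff_mset_residue_interval a0) auto
    obtain s t where st: "a 0 = a (i - 1) * s" "a i = a (j - 1) * t"
      using d by (meson dvdE)
    have "a (i - 1) > 0" "a (j - 1) > 0" using ij assms(2) by auto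
    with st show "of_nat ?l = gpsedf_lambda ?G A i j"
      unfolding lam[OF ij(1,2)] by (simp add: field_simps)
  qed
  have all: "\<exists>l::nat. of_nat l = gpsedf_lambda ?G A i j \<and> diff_mset ?G (A i) (A j) = group_mset l ?G"
    if ij: "i \<in> {1..m}" "j \<in> {1..m}" "i \<noteq> j" for i j
  proof (cases "i < j")
    case False
    \<comment> \<open>Now \<open>j < i\<close>; exchanging the two sets preserves both \<lambda> and
      the uniform multiplicity.\<close>
    then obtain l :: nat where "of_nat l = gpsedf_lambda ?G A j i" "diff_mset ?G (A j) (A i) = group_mset l ?G"
      using less ij by (metis linorder_neqE_nat)
    then show ?thesis
      using diff_mset_eq_group_mset_swap[OF fin sub sub] lam_sym by metis
  qed (use less ij in blast)
  have "nondisjoint_gpsedf ?G (a 0) m (\<lambda>i. \<eta> i * a i * (a 0 div a (i - 1))) A"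
    unfolding nondisjoint_gpsedf_def using fin order sub card all is_group by blast
  moreover have "lambda_matrix ?G m A $$ (i - 1, j - 1) =
      (if i = j then 0
       else of_nat (a 0 * \<eta> i * a i * \<eta> j * a j) / of_nat (a (i - 1) * a (j - 1)))"
    if "i \<in> {1..m}" "j \<in> {1..m}" for i j
  proof -
    \<comment> \<open>As \<open>i\<close> and \<open>j\<close> are at least 1, truncated subtraction
      is injective here and diagonal entries correspond to \<open>i = j\<close>.\<close>
    have "i - 1 < m" "j - 1 < m" "Suc (i - 1) = i" "Suc (j - 1) = j" "i - 1 = j - 1 \<longleftrightarrow> i = j"
      using that by auto
    then show ?thesis using lam[OF that] by (simp add: lambda_matrix_def)
  qed
  moreover have "dim_row (lambda_matrix ?G m A) = m" "dim_col (lambda_matrix ?G m A) = m"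
    by (simp_all add: lambda_matrix_def)
  ultimately show ?thesis by blast
qed

end
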